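(* For every integer $m\ge 0$, $$\sum_{s=0}^{m}JN_{s}^{(3)}=JN_{m+1}^{(3)}-\frac{1}{21}\left(7(1+\mathbf{i}+4\mathbf{j}+7\mathbf{k})-4VN_{m+1}^{(3)}+VN_{m}^{(3)}\right),$$ where $VN_{m}^{(3)}=V_{m}^{(3)}+V_{m+1}^{(3)}\mathbf{i}+V_{m+2}^{(3)}\mathbf{j}+V_{m+3}^{(3)}\mathbf{k}$.
   Context: Dual quaternions: the real algebra of elements $a+b\mathbf{i}+c\mathbf{j}+d\mathbf{k}$ ($a,b,c,d\in\mathbb{R}$) with componentwise addition and bilinear multiplication determined by $1$ being the identity and $\mathbf{i}^2=\mathbf{j}^2=\mathbf{k}^2=0$, $\mathbf{ij}=\mathbf{ji}=\mathbf{jk}=\mathbf{kj}=\mathbf{ik}=\mathbf{ki}=0$. The third-order Jacobsthal numbers are defined by $J_0^{(3)}=0$, $J_1^{(3)}=J_2^{(3)}=1$, $J_{n+3}^{(3)}=J_{n+2}^{(3)}+J_{n+1}^{(3)}+2J_n^{(3)}$ for $n\ge 0$. The superscript $(3)$ is part of the notation, not an exponent. The dual third-order Jacobsthal quaternions are $JN_m^{(3)}=J_m^{(3)}+J_{m+1}^{(3)}\mathbf{i}+J_{m+2}^{(3)}\mathbf{j}+J_{m+3}^{(3)}\mathbf{k}$ for $m\ge 0$. The sequence $V_n^{(3)}$ ($n\ge 0$) is given by $V_n^{(3)}=2$ if $n\equiv 0 \pmod 3$, $V_n^{(3)}=-3$ if $n\equiv 1\pmod 3$, $V_n^{(3)}=1$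 if $n\equiv 2\pmod 3$. *)

theory Defs
  imports Complex_Main
begin

section \<open>Dual quaternions\<close>

datatype dual_quat =
  Dual_Quat (dq_re: real) (dq_im1: real) (dq_im2: real) (dq_im3: real)

lemma dual_quat_eq_iff:
  "p = q \<longleftrightarrow> dq_re p = dq_re q \<and> dq_im1 p = dq_im1 q \<and> dq_im2 p = dq_im2 q \<and> dq_im3 p = dq_im3 q"
  by (cases p; cases q) simp

instantiation dual_quat :: real_vector
begin

definition "0 = Dual_Quat 0 0 0 0"

definition "p + q =
  Dual_Quat (dq_re p + dq_re q) (dq_im1 p + dq_im1 q) (dq_im2 p + dq_im2 q) (dq_im3 p + dq_im3 q)"

definition "- p = Dual_Quat (- dq_re p) (- dq_im1 p) (- dq_im2 p) (- dq_im3 p)"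

definition "p - q =
  Dual_Quat (dq_re p - dq_re q) (dq_im1 p - dq_im1 q) (dq_im2 p - dq_im2 q) (dq_im3 p - dq_im3 q)"

definition "r *\<^sub>R p = Dual_Quat (r * dq_re p) (r * dq_im1 p) (r * dq_im2 p) (r * dq_im3 p)"

instance
  by standard
    (simp_all add: zero_dual_quat_def plus_dual_quat_def uminus_dual_quat_def
      minus_dual_quat_def scaleR_dual_quat_def dual_quat_eq_iff algebra_simps)

end

text \<open>
  The product is the bilinear extension of the table in \<open>dual_quat_unit_mult\<close> below: every
  product of two imaginary units vanishes, so no products of imaginary coordinates occur.
\<close>

instantiation dual_quat :: "{real_algebra_1, comm_ring_1}"
begin

definition "1 = Dual_Quat 1 0 0 0"

definition "p * q =
  Dual_Quat (dq_re p * dq_re q)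
    (dq_re p * dq_im1 q + dq_im1 p * dq_re q)
    (dq_re p * dq_im2 q + dq_im2 p * dq_re q)
    (dq_re p * dq_im3 q + dq_im3 p * dq_re q)"

instance
  by standard
    (simp_all add: zero_dual_quat_def plus_dual_quat_def uminus_dual_quat_def
      minus_dual_quat_def scaleR_dual_quat_def one_dual_quat_def times_dual_quat_def
      dual_quat_eq_iff algebra_simps)

end

definition dq_i :: dual_quat where "dq_i = Dual_Quat 0 1 0 0"

definition dq_j :: dual_quat where "dq_j = Dual_Quat 0 0 1 0"

definition dq_k :: dual_quat where "dq_k = Dual_Quat 0 0 0 1"

lemma dual_quat_unit_mult:
  "dq_i * dq_i = 0" "dq_j * dq_j = 0" "dq_k * dq_k = 0"
  "dq_i * dq_j = 0" "dq_j * dq_i = 0" "dq_j * dq_k = 0"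
  "dq_k * dq_j = 0" "dq_i * dq_k = 0" "dq_k * dq_i = 0"
  by (simp_all add: dq_i_def dq_j_def dq_k_def times_dual_quat_def zero_dual_quat_def)

lemma Dual_Quat_eq:
  "Dual_Quat a b c d = of_real a + b *\<^sub>R dq_i + c *\<^sub>R dq_j + d *\<^sub>R dq_k"
  by (simp add: of_real_def dq_i_def dq_j_def dq_k_def one_dual_quat_def plus_dual_quat_def
      scaleR_dual_quat_def)


section \<open>Third-order Jacobsthal numbers and quaternions\<close>

fun J3 :: "nat \<Rightarrow> real" where
  "J3 0 = 0"
| "J3 (Suc 0) = 1"
| "J3 (Suc (Suc 0)) = 1"
| "J3 (Suc (Suc (Suc n))) = J3 (Suc (Suc n)) + J3 (Suc n) + 2 * J3 n"

definition JN3 :: "nat \<Rightarrow> dual_quat" where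
  "JN3 m = of_real (J3 m) + J3 (m + 1) *\<^sub>R dq_i + J3 (m + 2) *\<^sub>R dq_j + J3 (m + 3) *\<^sub>R dq_k"

definition V3 :: "nat \<Rightarrow> real" where
  "V3 n = (if n mod 3 = 0 then 2 else if n mod 3 = 1 then - 3 else 1)"

definition VN3 :: "nat \<Rightarrow> dual_quat" where
  "VN3 m = of_real (V3 m) + V3 (m + 1) *\<^sub>R dq_i + V3 (m + 2) *\<^sub>R dq_j + V3 (m + 3) *\<^sub>R dq_k"

end

theory Submission
  imports Defs
begin

text \<open>
  The defect \<open>D n = J3 (n + 1) - 2 * J3 n\<close> satisfies \<open>D (n + 2) = - D (n + 1) - D n\<close>,
  since \<open>2\<close> is a root of the characteristic polynomial \<open>x^3 - x^2 - x - 2 = (x - 2) (x^2 + x + 1)\<close>.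
  The sequence \<open>V3\<close> satisfies the same recurrence, so \<open>D\<close> is a combination of shifts of \<open>V3\<close>.
  In each coordinate this relation is the induction step of the summation formula.
\<close>

lemma V3_rec: "V3 (Suc (Suc n)) = - V3 (Suc n) - V3 n"
proof -
  have "n mod 3 = 0 \<or> n mod 3 = 1 \<or> n mod 3 = 2"
    by linarith
  then show ?thesis
    by (auto simp: V3_def mod_Suc)
qed

text \<open>The weights \<open>3 / 7\<close> and \<open>1 / 7\<close> are determined by the cases
  \<open>n = 0\<close> and \<open>n = 1\<close>.\<close>

lemma J3_Suc_Suc: "J3 (Suc (Suc n)) = 2 * J3 (Suc n) + (3 * V3 (Suc n) + V3 n) / 7"
proof (induction n rule: less_induct)
  case (less n)
  consider "n = 0" | "n = 1" | k where "n = Suc (Suc k)"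
    by (metis One_nat_def not0_implies_Suc)
  then show ?case
  proof cases
    case 3
    then show ?thesis
      using less.IH[of k] less.IH[of "Suc k"] by (simp add: V3_rec field_simps)
  qed (simp_all add: V3_def)
qed

text \<open>The offset \<open>c\<close> serves all four coordinates at once; the terms in
  \<open>c\<close> alone make \<open>m = 0\<close> an identity.\<close>

lemma sum_J3_shift:
  "(\<Sum>s = 0..m. J3 (s + c)) =
    J3 (m + (c + 1)) - J3 (c + 1) + J3 c
      + (4 * V3 (m + (c + 1)) - V3 (m + c) - 4 * V3 (c + 1) + V3 c) / 21"
proof (induction m)
  case (Suc m)
  then show ?case
    \<comment> \<open>By \<open>V3_rec\<close> the \<open>V3\<close> part changes by
      \<open>- (3 * V3 (Suc (m + c)) + V3 (m + c)) / 7\<close>.\<close>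
    using J3_Suc_Suc[of "m + c"] by (simp add: V3_rec field_simps)
qed simp

lemma dual_quat_sums:
  "dq_re (sum f A) = (\<Sum>x\<in>A. dq_re (f x))"
  "dq_im1 (sum f A) = (\<Sum>x\<in>A. dq_im1 (f x))"
  "dq_im2 (sum f A) = (\<Sum>x\<in>A. dq_im2 (f x))"
  "dq_im3 (sum f A) = (\<Sum>x\<in>A. dq_im3 (f x))"
  by (induction A rule: infinite_finite_induct)
    (simp_all add: zero_dual_quat_def plus_dual_quat_def)

theorem theorem2p3:
  fixes m :: nat
  shows "(\<Sum>s = 0..m. JN3 s) =
    JN3 (m + 1) - (1 / 21) *\<^sub>R
      (7 *\<^sub>R (1 + dq_i + 4 *\<^sub>R dq_j + 7 *\<^sub>R dq_k) - 4 *\<^sub>R VN3 (m + 1) + VN3 m)"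
proof -
  have JN3: "JN3 n = Dual_Quat (J3 n) (J3 (n + 1)) (J3 (n + 2)) (J3 (n + 3))" for n
    by (simp only: JN3_def Dual_Quat_eq)
  have VN3: "VN3 n = Dual_Quat (V3 n) (V3 (n + 1)) (V3 (n + 2)) (V3 (n + 3))" for n
    by (simp only: VN3_def Dual_Quat_eq)
  have J3_init: "J3 1 = 1" "J3 2 = 1" "J3 3 = 2" "J3 4 = 5"
    by (simp_all add: eval_nat_numeral)
  have V3_init: "V3 0 = 2" "V3 1 = - 3" "V3 2 = 1" "V3 3 = 2" "V3 4 = - 3"
    by (simp_all add: V3_def)
  \<comment> \<open>The constants 7, 7, 28, 49 are
    \<open>21 * (J3 (c + 1) - J3 c) + 4 * V3 (c + 1) - V3 c\<close> for \<open>c\<close> from 0 to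
    3.\<close>
  have sums:
    "(\<Sum>s = 0..m. J3 s) = J3 (m + 1) - (7 - 4 * V3 (m + 1) + V3 m) / 21"
    "(\<Sum>s = 0..m. J3 (s + 1)) = J3 (m + 2) - (7 - 4 * V3 (m + 2) + V3 (m + 1)) / 21"
    "(\<Sum>s = 0..m. J3 (s + 2)) = J3 (m + 3) - (28 - 4 * V3 (m + 3) + V3 (m + 2)) / 21"
    "(\<Sum>s = 0..m. J3 (s + 3)) = J3 (m + 4) - (49 - 4 * V3 (m + 4) + V3 (m + 3)) / 21"
    using sum_J3_shift[of 0 m] sum_J3_shift[of 1 m] sum_J3_shift[of 2 m] sum_J3_shift[of 3 m]
      J3_init V3_init by (simp_all add: field_simps del: J3.simps(2-) One_nat_def)
  show ?thesis
    unfolding dual_quat_eq_iff dual_quat_sums JN3 VN3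
    by (simp add: sums plus_dual_quat_def minus_dual_quat_def scaleR_dual_quat_def
        one_dual_quat_def dq_i_def dq_j_def dq_k_def add.assoc
        del: One_nat_def add_2_eq_Suc')
qed

end
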